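(* There is a path $(\{P_q\}_{q=1}^Q,\{s_q\}_{q=0}^Q)\in\mathcal A_{\mathcal W_{min}}$, with associated error supersolution $\{\gamma_q\}_{q=0}^Q$, such that for all $q=1,\dots,Q-1$ both $$P_q=1\qquad\text{and}\qquad \kappa(s_q)-\kappa(s_{q-1})+\gamma_{q-1}=\delta(s_q)$$ hold. This uniquely determines $Q$. Furthermore, this path has the lowest estimated error $\gamma_Q$ (the final value of the error supersolution) of all paths in $\mathcal A_{\mathcal W_{min}}$.
   Context: Fixed data: $\epsilon>0$; $\kappa:[0,1]\to[0,\infty)$ continuous and strictly increasing; $\delta:[0,1]\to(0,\infty)$ continuous and decreasing; $0\le\gamma_0<\delta(0)$; and $0<\alpha<1$. For a pair $(\{P_q\}_{q=1}^Q,\{s_q\}_{q=0}^Q)$, the error supersolution $\{\gamma_q\}_{q=0}^Q$ starts from the given $\gamma_0$ and is defined by the recurrence $$\gamma_q=\alpha^{P_q}\big(\kappa(s_q)-\kappa(s_{q-1})+\gamma_{q-1}\big),\qquad q=1,\dots,Q.$$ The set $\mathcal A$ of admissible loading paths consists of all pairs $(\{P_q\}_{q=1}^Q,\{s_q\}_{q=0}^Q)$, over all integers $Q\ge1$, such that: - $P_1,\dots,P_{Q-1}$ are positive integers and $P_Q$ is a nonnegative integer; - $0=s_0\le s_1\le\dots\le s_Q=1$; - $\kappa(s_q)-\kappa(s_{q-1})+\gamma_{q-1}\le\delta(s_q)$ for all $q=1,\dots,Q$; - $\gamma_Q\le\epsilon$. The work of a path is $\sum_{q=1}^Q P_q$,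 and $\mathcal W_{min}$ denotes the minimum of the work over all paths in $\mathcal A$ (the set $\mathcal A$ is non-empty and the work is integer-valued and nonnegative, so the minimum exists). For $m\ge0$, $\mathcal A_m$ denotes the set of all paths in $\mathcal A$, with any $Q\ge1$, whose work satisfies $\sum_{q=1}^Q P_q\le m$.
   Formalization: Q is not always unique: if the last step to load 1 also meets its tolerance with equality, it may split into two steps at load 1. Proved instead: the path has s_q<1 for q<Q, and any other path with these properties has the same Q, or has Q+1 steps with its s_Q=1. *)

theory Defs
  imports Complex_Main
begin

(* A loading path is a triple (Q, P, s): the number Q of load steps, the iteration counts
   P 1, ..., P Q and the load parameters s 0, ..., s Q.  Values of P and s outside these index
   ranges are junk: they are not constrained and nothing below depends on them. *)
type_synonym path = "nat \<times> (nat \<Rightarrow> nat) \<times> (nat \<Rightarrow> real)"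

primrec err ::
  "(real \<Rightarrow> real) \<Rightarrow> real \<Rightarrow> real \<Rightarrow> (nat \<Rightarrow> nat) \<Rightarrow> (nat \<Rightarrow> real) \<Rightarrow> nat \<Rightarrow> real" where
  "err \<kappa> \<gamma>0 \<alpha> P s 0 = \<gamma>0"
| "err \<kappa> \<gamma>0 \<alpha> P s (Suc q) =
     \<alpha> ^ P (Suc q) * (\<kappa> (s (Suc q)) - \<kappa> (s q) + err \<kappa> \<gamma>0 \<alpha> P s q)"

definition admissible ::
  "real \<Rightarrow> (real \<Rightarrow> real) \<Rightarrow> (real \<Rightarrow> real) \<Rightarrow> real \<Rightarrow> real \<Rightarrow> path set" where
  "admissible \<epsilon> \<kappa> \<delta> \<gamma>0 \<alpha> = {(Q, P, s).
     Q \<ge> 1 \<and> (\<forall>q\<in>{1..<Q}. P q \<ge> 1) \<and>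
     s 0 = 0 \<and> s Q = 1 \<and> (\<forall>q\<in>{1..Q}. s (q - 1) \<le> s q) \<and>
     (\<forall>q\<in>{1..Q}. \<kappa> (s q) - \<kappa> (s (q - 1)) + err \<kappa> \<gamma>0 \<alpha> P s (q - 1) \<le> \<delta> (s q)) \<and>
     err \<kappa> \<gamma>0 \<alpha> P s Q \<le> \<epsilon>}"

fun work :: "path \<Rightarrow> nat" where
  "work (Q, P, s) = (\<Sum>q=1..Q. P q)"

definition W_min ::
  "real \<Rightarrow> (real \<Rightarrow> real) \<Rightarrow> (real \<Rightarrow> real) \<Rightarrow> real \<Rightarrow> real \<Rightarrow> nat" where
  "W_min \<epsilon> \<kappa> \<delta> \<gamma>0 \<alpha> = (LEAST m. \<exists>p\<in>admissible \<epsilon> \<kappa> \<delta> \<gamma>0 \<alpha>. work p = m)"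

definition admissible_upto ::
  "real \<Rightarrow> (real \<Rightarrow> real) \<Rightarrow> (real \<Rightarrow> real) \<Rightarrow> real \<Rightarrow> real \<Rightarrow> nat \<Rightarrow> path set" where
  "admissible_upto \<epsilon> \<kappa> \<delta> \<gamma>0 \<alpha> m = {p \<in> admissible \<epsilon> \<kappa> \<delta> \<gamma>0 \<alpha>. work p \<le> m}"

(* All load steps but the last use one iteration and exhaust the error tolerance. *)
fun saturated ::
  "(real \<Rightarrow> real) \<Rightarrow> (real \<Rightarrow> real) \<Rightarrow> real \<Rightarrow> real \<Rightarrow> path \<Rightarrow> bool" where
  "saturated \<kappa> \<delta> \<gamma>0 \<alpha> (Q, P, s) \<longleftrightarrow>
     (\<forall>q\<in>{1..<Q}. P q = 1 \<and>
        \<kappa> (s q) - \<kappa> (s (q - 1)) + err \<kappa> \<gamma>0 \<alpha> P s (q - 1) = \<delta> (s q))"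

end

theory Submission
  imports Defs
begin

text \<open>
  The proof replaces the error by the level \<open>c\<^sub>q = \<kappa>(s\<^sub>q) - \<gamma>\<^sub>q\<close>. In terms of the level, the
  tolerance condition of a step to load \<open>x\<close> reads \<open>\<kappa>(x) - \<delta>(x) \<le> c\<close>, each iteration at load \<open>x\<close>
  replaces \<open>c\<close> by the convex combination \<open>(1 - \<alpha>) \<kappa>(x) + \<alpha> c\<close>, and the final error is
  \<open>\<kappa>(1) - c\<^sub>Q\<close>. Everything is monotone: a higher level permits a higher load, and a higher load and
  a higher level give a higher next level. So the greedy strategy, which before every single
  iteration raises the load to the largest permitted value \<open>reach c\<close>, has after \<open>n\<close> iterations the
  highest level that any path of work \<open>n\<close> can have (\<open>level_le_greedy\<close>).

  The function \<open>\<kappa> - \<delta>\<close> is continuous and strictly increasing, so a greedy step that does not arrive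
  at load 1 meets its tolerance with equality. Such a step raises the level by at least
  \<open>(1 - \<alpha>) \<delta>(1)\<close>; hence load 1 comes within reach after some least number \<open>N\<close> of iterations, and
  from then on the error decays geometrically. Gathering all iterations after the \<open>N\<close>-th in one
  last step yields a saturated path with \<open>Q = N + 1\<close> for every work \<open>m \<ge> N\<close>. An admissible path of
  minimal work shows, by comparison with the greedy levels, that the greedy path of that same work
  is admissible, and the comparison also shows that its error is the lowest one.

  Conversely, a saturated path follows the greedy levels up to its last step. This step is
  possible only if \<open>Q' - 1 \<ge> N\<close>, whereas a step that meets its tolerance with equality is possible
  only as long as the level is at most \<open>\<kappa>(1) - \<delta>(1)\<close>, which fails from \<open>N + 1\<close> on. Only the
  borderline case where the level at \<open>N\<close> equals \<open>\<kappa>(1) - \<delta>(1)\<close> leaves room for one more step.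
\<close>

locale loading =
  fixes \<kappa> \<delta> :: "real \<Rightarrow> real" and \<gamma>0 \<alpha> :: real
  assumes cont_\<kappa>: "continuous_on {0..1} \<kappa>" and strict_\<kappa>: "strict_mono_on {0..1} \<kappa>"
    and cont_\<delta>: "continuous_on {0..1} \<delta>" and anti_\<delta>: "antimono_on {0..1} \<delta>"
    and pos_\<delta>: "\<And>x. x \<in> {0..1} \<Longrightarrow> \<delta> x > 0"
    and \<gamma>0_nonneg: "0 \<le> \<gamma>0" and \<gamma>0_less: "\<gamma>0 < \<delta> 0"
    and \<alpha>_pos: "0 < \<alpha>" and \<alpha>_less_1: "\<alpha> < 1"
begin

section \<open>The largest permitted load\<close>

text \<open>The least level at which the tolerance permits a step to load \<open>x\<close>.\<close>

definition threshold :: "real \<Rightarrow> real" where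
  "threshold x = \<kappa> x - \<delta> x"

definition reach :: "real \<Rightarrow> real" where
  "reach c = Sup {x \<in> {0..1}. threshold x \<le> c}"

lemma \<kappa>_mono: "x \<in> {0..1} \<Longrightarrow> y \<in> {0..1} \<Longrightarrow> x \<le> y \<Longrightarrow> \<kappa> x \<le> \<kappa> y"
  using strict_mono_onD[OF strict_\<kappa>, of x y] by (cases "x = y") auto

lemma \<delta>_anti: "x \<in> {0..1} \<Longrightarrow> y \<in> {0..1} \<Longrightarrow> x \<le> y \<Longrightarrow> \<delta> y \<le> \<delta> x"
  using anti_\<delta> by (auto simp: monotone_on_def)

lemma threshold_less: "x \<in> {0..1} \<Longrightarrow> y \<in> {0..1} \<Longrightarrow> x < y \<Longrightarrow> threshold x < threshold y"
  using strict_mono_onD[OF strict_\<kappa>, of x y] \<delta>_anti[of x y] by (simp add: threshold_def)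

lemma threshold_le_iff:
  "x \<in> {0..1} \<Longrightarrow> y \<in> {0..1} \<Longrightarrow> threshold x \<le> threshold y \<longleftrightarrow> x \<le> y"
  using threshold_less[of x y] threshold_less[of y x] by (cases x y rule: linorder_cases) auto

lemma threshold_less_\<kappa>: "x \<in> {0..1} \<Longrightarrow> threshold x < \<kappa> x"
  using pos_\<delta> by (simp add: threshold_def)

lemma reach_threshold:
  assumes "x \<in> {0..1}"
  shows "reach (threshold x) = x"
  unfolding reach_def using assms by (intro cSup_eq_maximum) (auto simp: threshold_le_iff)

lemma reach_eq_1:
  assumes "threshold 1 \<le> c"
  shows "reach c = 1"
  unfolding reach_def using assms by (intro cSup_eq_maximum) auto

text \<open>By the intermediate value theorem, every level between the two extreme thresholds is the
  threshold of some load.\<close>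

lemma threshold_reach:
  assumes "threshold 0 \<le> c" "c \<le> threshold 1"
  shows "reach c \<in> {0..1}" "threshold (reach c) = c"
proof -
  have "continuous_on {0..1} threshold"
    unfolding threshold_def by (intro continuous_intros cont_\<kappa> cont_\<delta>)
  then obtain x where "0 \<le> x" "x \<le> 1" "threshold x = c"
    using IVT'[of threshold 0 c 1] assms by auto
  then show "reach c \<in> {0..1}" "threshold (reach c) = c"
    using reach_threshold[of x] by auto
qed

lemma reach_mem: "threshold 0 \<le> c \<Longrightarrow> reach c \<in> {0..1}"
  using threshold_reach(1)[of c] reach_eq_1[of c] by (cases "c \<le> threshold 1") auto

lemma threshold_reach_le: "threshold 0 \<le> c \<Longrightarrow> threshold (reach c) \<le> c"
  using threshold_reach(2)[of c] reach_eq_1[of c] by (cases "c \<le> threshold 1") auto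

lemma le_reach:
  assumes "x \<in> {0..1}" "threshold x \<le> c"
  shows "x \<le> reach c"
  unfolding reach_def using assms by (intro cSup_upper) (auto intro: bdd_aboveI[of _ 1])

lemma reach_less_1:
  assumes "threshold 0 \<le> c" "c < threshold 1"
  shows "reach c < 1"
  using assms threshold_reach[of c] by (cases "reach c = 1") auto

lemma reach_mono:
  assumes "threshold 0 \<le> c" "c \<le> d"
  shows "reach c \<le> reach d"
  using assms reach_mem[of c] threshold_reach_le[of c] by (intro le_reach) auto

lemma le_\<kappa>_reach:
  assumes "threshold 0 \<le> c" "c \<le> \<kappa> 1"
  shows "c \<le> \<kappa> (reach c)"
  using assms threshold_reach[of c] threshold_less_\<kappa>[of "reach c"] reach_eq_1[of c]
  by (cases "c \<le> threshold 1") auto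

section \<open>Greedy levels\<close>

primrec greedy :: "nat \<Rightarrow> real" where
  "greedy 0 = \<kappa> 0 - \<gamma>0"
| "greedy (Suc n) = \<kappa> (reach (greedy n)) - \<alpha> * (\<kappa> (reach (greedy n)) - greedy n)"

text \<open>The lower bound makes \<open>reach\<close> meaningful at every greedy level. The upper bound is a nonnegative
  error at load 1; it makes \<open>\<kappa>\<close> at the reached load no less than the level (\<open>le_\<kappa>_reach\<close>), so
  that averaging the two cannot lower the level.\<close>

lemma greedy_bounds: "threshold 0 < greedy n \<and> greedy n \<le> greedy (Suc n) \<and> greedy n \<le> \<kappa> 1"
proof -
  have incr: "c \<le> \<kappa> (reach c) - \<alpha> * (\<kappa> (reach c) - c)"
    if "threshold 0 < c" "c \<le> \<kappa> 1" for c
    using mult_right_mono[of \<alpha> 1 "\<kappa> (reach c) - c"] le_\<kappa>_reach[of c] that \<alpha>_less_1 by simp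
  show ?thesis
  proof (induction n)
    case 0
    have "threshold 0 < greedy 0" "greedy 0 \<le> \<kappa> 1"
      using \<gamma>0_less \<gamma>0_nonneg \<kappa>_mono[of 0 1] by (auto simp: threshold_def)
    then show ?case using incr[of "greedy 0"] by simp
  next
    case (Suc n)
    then have "0 \<le> \<alpha> * (\<kappa> (reach (greedy n)) - greedy n)"
      using le_\<kappa>_reach[of "greedy n"] \<alpha>_pos by simp
    moreover have "\<kappa> (reach (greedy n)) \<le> \<kappa> 1"
      using reach_mem[of "greedy n"] Suc by (intro \<kappa>_mono) auto
    ultimately have "greedy (Suc n) \<le> \<kappa> 1" by simp
    then show ?case using Suc incr[of "greedy (Suc n)"] by simp
  qed
qed

lemma threshold_0_le_greedy: "threshold 0 \<le> greedy n"
  using greedy_bounds[of n] by simp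

lemma greedy_mono: "m \<le> n \<Longrightarrow> greedy m \<le> greedy n"
  by (rule lift_Suc_mono_le[of greedy]) (use greedy_bounds in blast)+

text \<open>Below the threshold of load 1, a greedy step exhausts its tolerance and gains
  \<open>(1 - \<alpha>) \<delta>(x)\<close> at its load \<open>x\<close>, which is at least \<open>(1 - \<alpha>) \<delta>(1)\<close>.\<close>

lemma ex_greedy_ge_threshold_1: "\<exists>n. threshold 1 \<le> greedy n"
proof (rule ccontr)
  assume "\<not> ?thesis"
  then have below: "greedy n < threshold 1" for n by (simp add: not_le)
  have lin: "greedy 0 + n * ((1 - \<alpha>) * \<delta> 1) \<le> greedy n" for n
  proof (induction n)
    case (Suc n)
    let ?x = "reach (greedy n)"
    have x: "?x \<in> {0..1}" "threshold ?x = greedy n"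
      using threshold_reach[of "greedy n"] threshold_0_le_greedy below less_imp_le by blast+
    have "(1 - \<alpha>) * \<delta> 1 \<le> (1 - \<alpha>) * \<delta> ?x"
      using \<delta>_anti[of ?x 1] x(1) \<alpha>_less_1 by (intro mult_left_mono) auto
    also have "\<dots> = (1 - \<alpha>) * (\<kappa> ?x - greedy n)"
      using x(2) by (simp add: threshold_def)
    also have "\<dots> = greedy (Suc n) - greedy n"
      by (simp add: algebra_simps)
    finally show ?case using Suc by (simp add: distrib_right del: greedy.simps)
  qed simp
  have "0 < (1 - \<alpha>) * \<delta> 1" using pos_\<delta>[of 1] \<alpha>_less_1 by simp
  then obtain n where "threshold 1 - greedy 0 < real n * ((1 - \<alpha>) * \<delta> 1)"
    using reals_Archimedean3 by blast
  then show False using lin[of n] below[of n] by linarith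
qed

definition N :: nat where
  "N = (LEAST n. threshold 1 \<le> greedy n)"

lemma threshold_1_le_greedy_iff: "threshold 1 \<le> greedy n \<longleftrightarrow> N \<le> n"
proof
  show "N \<le> n" if "threshold 1 \<le> greedy n" unfolding N_def using that by (rule Least_le)
  have "threshold 1 \<le> greedy N"
    unfolding N_def using ex_greedy_ge_threshold_1 by (rule LeastI_ex)
  then show "threshold 1 \<le> greedy n" if "N \<le> n" using greedy_mono[OF that] by simp
qed

lemma greedy_after_N: "\<kappa> 1 - greedy (N + k) = \<alpha> ^ k * (\<kappa> 1 - greedy N)"
proof (induction k)
  case (Suc k)
  have "reach (greedy (N + k)) = 1"
    by (intro reach_eq_1) (simp add: threshold_1_le_greedy_iff)
  then have "\<kappa> 1 - greedy (N + Suc k) = \<alpha> * (\<kappa> 1 - greedy (N + k))" by simp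
  also have "\<dots> = \<alpha> ^ Suc k * (\<kappa> 1 - greedy N)" unfolding Suc.IH by simp
  finally show ?case .
qed simp

text \<open>One iteration at load 1 averages the level with \<open>\<kappa> 1\<close>, which exceeds the threshold by
  \<open>\<delta> 1 > 0\<close>; so even a level that just attains the threshold ends up strictly above it.\<close>

lemma greedy_gt_threshold_1:
  assumes "N < n"
  shows "threshold 1 < greedy n"
proof -
  have "\<alpha> * (\<kappa> 1 - greedy N) \<le> \<alpha> * (\<kappa> 1 - threshold 1)"
    using \<alpha>_pos threshold_1_le_greedy_iff[of N] by (intro mult_left_mono) auto
  also have "\<dots> < \<kappa> 1 - threshold 1"
    using threshold_less_\<kappa>[of 1] \<alpha>_less_1 by simp
  finally have "threshold 1 < greedy (Suc N)" using greedy_after_N[of 1] by simp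
  also have "\<dots> \<le> greedy n" using assms by (intro greedy_mono) simp
  finally show ?thesis .
qed

section \<open>Every admissible path is dominated by the greedy levels\<close>

definition level :: "(nat \<Rightarrow> nat) \<Rightarrow> (nat \<Rightarrow> real) \<Rightarrow> nat \<Rightarrow> real" where
  "level P s q = \<kappa> (s q) - err \<kappa> \<gamma>0 \<alpha> P s q"

lemma level_0: "s 0 = 0 \<Longrightarrow> level P s 0 = greedy 0"
  by (simp add: level_def)

lemma level_Suc: "level P s (Suc q) = \<kappa> (s (Suc q)) - \<alpha> ^ P (Suc q) * (\<kappa> (s (Suc q)) - level P s q)"
  by (simp add: level_def algebra_simps)

lemma tolerance_iff:
  "\<kappa> (s (Suc q)) - \<kappa> (s q) + err \<kappa> \<gamma>0 \<alpha> P s q \<le> \<delta> (s (Suc q)) \<longleftrightarrow> threshold (s (Suc q)) \<le> level P s q"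
  "\<kappa> (s (Suc q)) - \<kappa> (s q) + err \<kappa> \<gamma>0 \<alpha> P s q = \<delta> (s (Suc q)) \<longleftrightarrow> threshold (s (Suc q)) = level P s q"
  by (auto simp: threshold_def level_def)

lemma admissible_iff:
  "(Q, P, s) \<in> admissible \<epsilon> \<kappa> \<delta> \<gamma>0 \<alpha> \<longleftrightarrow>
     Q \<ge> 1 \<and> (\<forall>q\<in>{1..<Q}. P q \<ge> 1) \<and> s 0 = 0 \<and> s Q = 1 \<and> (\<forall>q<Q. s q \<le> s (Suc q)) \<and>
     (\<forall>q<Q. threshold (s (Suc q)) \<le> level P s q) \<and> \<kappa> 1 - level P s Q \<le> \<epsilon>"
proof -
  have "(\<forall>q\<in>{1..Q}. R q) \<longleftrightarrow> (\<forall>q<Q. R (Suc q))" for R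
    unfolding image_Suc_lessThan[symmetric] by auto
  then have shift: "(\<forall>q\<in>{Suc 0..Q}. R q) \<longleftrightarrow> (\<forall>q<Q. R (Suc q))" for R
    by simp
  show ?thesis
    by (simp add: admissible_def shift tolerance_iff) (auto simp: level_def)
qed

lemma admissible_loads:
  assumes "(Q, P, s) \<in> admissible \<epsilon> \<kappa> \<delta> \<gamma>0 \<alpha>" "q \<le> Q"
  shows "s q \<in> {0..1}"
proof -
  have step: "s q \<le> s (Suc q)" if "q < Q" for q using assms(1) that by (simp add: admissible_iff)
  have "s 0 \<le> s q" using assms(2) step
    by (induction q) (auto intro: order_trans)
  moreover have "s q \<le> s Q" using assms(2)
    by (induction q rule: inc_induct) (auto intro: order_trans step)
  ultimately show ?thesis using assms(1) by (simp add: admissible_iff)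
qed

text \<open>Several iterations at one fixed load do not beat equally many greedy steps: the level never
  falls, so the load stays permitted, hence within reach of the greedy level, throughout.\<close>

lemma iterations_le_greedy:
  assumes x: "x \<in> {0..1}" "threshold x \<le> c" "c \<le> \<kappa> x" and c: "c \<le> greedy n"
  shows "\<kappa> x - \<alpha> ^ k * (\<kappa> x - c) \<le> greedy (n + k)"
proof (induction k)
  case (Suc k)
  let ?c = "\<kappa> x - \<alpha> ^ k * (\<kappa> x - c)" and ?g = "greedy (n + k)"
  have "\<alpha> ^ k * (\<kappa> x - c) \<le> 1 * (\<kappa> x - c)"
    using x \<alpha>_pos \<alpha>_less_1 by (intro mult_right_mono) (auto intro: power_le_one)
  then have "c \<le> ?c" by simp
  then have "threshold x \<le> ?g" using Suc x(2) by (meson order_trans)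
  then have "x \<le> reach ?g" using le_reach x(1) by blast
  then have "\<kappa> x \<le> \<kappa> (reach ?g)"
    using x(1) reach_mem[OF threshold_0_le_greedy] by (intro \<kappa>_mono) auto
  then have "(1 - \<alpha>) * \<kappa> x + \<alpha> * ?c \<le> (1 - \<alpha>) * \<kappa> (reach ?g) + \<alpha> * ?g"
    using Suc \<alpha>_pos \<alpha>_less_1 by (intro add_mono mult_left_mono) auto
  then show ?case by (simp add: algebra_simps)
qed (use c in simp)

lemma level_le_greedy:
  assumes adm: "(Q, P, s) \<in> admissible \<epsilon> \<kappa> \<delta> \<gamma>0 \<alpha>" and "q \<le> Q"
  shows "level P s q \<le> \<kappa> (s q) \<and> level P s q \<le> greedy (\<Sum>i=1..q. P i)"
  using \<open>q \<le> Q\<close>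
proof (induction q)
  case 0
  then show ?case using adm \<gamma>0_nonneg by (simp add: admissible_iff level_def)
next
  case (Suc q)
  let ?x = "s (Suc q)" and ?c = "level P s q"
  have x: "?x \<in> {0..1}" and "s q \<in> {0..1}" "s q \<le> ?x" "threshold ?x \<le> ?c"
    using Suc.prems adm admissible_loads[OF adm, of q] admissible_loads[OF adm, of "Suc q"]
    by (auto simp: admissible_iff)
  then have c: "?c \<le> \<kappa> ?x" using Suc \<kappa>_mono[of "s q" ?x] by simp
  have "\<kappa> ?x - \<alpha> ^ P (Suc q) * (\<kappa> ?x - ?c) \<le> greedy ((\<Sum>i=1..q. P i) + P (Suc q))"
    using x \<open>threshold ?x \<le> ?c\<close> c Suc by (intro iterations_le_greedy) auto
  then show ?case using c \<alpha>_pos by (simp add: level_Suc)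
qed

text \<open>Load 1 is permitted at the last level but one, which the last step does not lower; hence
  it is within reach of the greedy level for the full work.\<close>

lemma admissible_imp_greedy:
  assumes adm: "(Q, P, s) \<in> admissible \<epsilon> \<kappa> \<delta> \<gamma>0 \<alpha>"
  shows "N \<le> work (Q, P, s)" "\<kappa> 1 - greedy (work (Q, P, s)) \<le> err \<kappa> \<gamma>0 \<alpha> P s Q"
proof -
  obtain q where q: "Q = Suc q" using adm by (cases Q) (auto simp: admissible_iff)
  have "level P s q \<le> greedy (\<Sum>i=1..q. P i)" using level_le_greedy[OF adm, of q] q by simp
  also have "\<dots> \<le> greedy (work (Q, P, s))" by (intro greedy_mono) (simp add: q)
  finally have "threshold 1 \<le> greedy (work (Q, P, s))" using adm q by (auto simp: admissible_iff)
  then show "N \<le> work (Q, P, s)" by (simp add: threshold_1_le_greedy_iff)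
  show "\<kappa> 1 - greedy (work (Q, P, s)) \<le> err \<kappa> \<gamma>0 \<alpha> P s Q"
    using level_le_greedy[OF adm, of Q] adm by (simp add: admissible_iff level_def)
qed

section \<open>The greedy path\<close>

definition greedy_loads :: "nat \<Rightarrow> real" where
  "greedy_loads q = (case q of 0 \<Rightarrow> 0 | Suc n \<Rightarrow> reach (greedy n))"

text \<open>The last step, with index \<open>N + 1\<close>, takes all iterations that remain of the total \<open>m\<close>, possibly
  none.\<close>

definition greedy_counts :: "nat \<Rightarrow> nat \<Rightarrow> nat" where
  "greedy_counts m q = (if q \<le> N then 1 else m - N)"

lemma greedy_loads_simps [simp]:
  "greedy_loads 0 = 0" "greedy_loads (Suc n) = reach (greedy n)"
  by (simp_all add: greedy_loads_def)

lemma reach_greedy_N [simp]: "reach (greedy N) = 1"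
  by (intro reach_eq_1) (simp add: threshold_1_le_greedy_iff)

lemma greedy_loads_less_1: "q \<le> N \<Longrightarrow> greedy_loads q < 1"
  using reach_less_1[OF threshold_0_le_greedy, of "q - 1"] threshold_1_le_greedy_iff[of "q - 1"]
  by (cases q) (auto simp: not_le)

lemma level_greedy: "q \<le> N \<Longrightarrow> level (greedy_counts m) greedy_loads q = greedy q"
  by (induction q) (simp_all add: level_0 level_Suc greedy_counts_def)

lemma level_greedy_final:
  assumes "N \<le> m"
  shows "level (greedy_counts m) greedy_loads (Suc N) = greedy m"
  using greedy_after_N[of "m - N"] assms
  by (simp add: level_Suc level_greedy greedy_counts_def)

lemma err_greedy_final:
  assumes "N \<le> m"
  shows "err \<kappa> \<gamma>0 \<alpha> (greedy_counts m) greedy_loads (Suc N) = \<kappa> 1 - greedy m"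
  using level_greedy_final[OF assms] by (simp add: level_def del: err.simps)

lemma work_greedy: "N \<le> m \<Longrightarrow> work (Suc N, greedy_counts m, greedy_loads) = m"
  by (simp add: greedy_counts_def)

lemma admissible_greedy:
  assumes "N \<le> m" "\<kappa> 1 - greedy m \<le> \<epsilon>"
  shows "(Suc N, greedy_counts m, greedy_loads) \<in> admissible \<epsilon> \<kappa> \<delta> \<gamma>0 \<alpha>"
proof -
  have "greedy_loads q \<le> greedy_loads (Suc q)" for q
    using reach_mem[OF threshold_0_le_greedy, of 0] reach_mono[OF threshold_0_le_greedy] greedy_mono
    by (cases q) (auto simp del: greedy.simps)
  moreover have "threshold (reach (greedy q)) \<le> greedy q" for q
    using threshold_reach_le threshold_0_le_greedy by blast
  ultimately show ?thesis using assms
    by (auto simp: admissible_iff level_greedy level_greedy_final greedy_counts_def)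
qed

lemma saturated_iff:
  "saturated \<kappa> \<delta> \<gamma>0 \<alpha> (Suc n, P, s) \<longleftrightarrow>
     (\<forall>q<n. P (Suc q) = 1 \<and> threshold (s (Suc q)) = level P s q)"
proof -
  have shift: "(\<forall>q\<in>{1..<Suc n}. R q) \<longleftrightarrow> (\<forall>q<n. R (Suc q))" for R
    unfolding atLeastLessThanSuc_atLeastAtMost image_Suc_lessThan[symmetric] by auto
  show ?thesis unfolding saturated.simps shift by (simp add: tolerance_iff)
qed

declare saturated.simps [simp del]

lemma saturated_greedy: "saturated \<kappa> \<delta> \<gamma>0 \<alpha> (Suc N, greedy_counts m, greedy_loads)"
proof -
  have "threshold (reach (greedy q)) = greedy q" if "q < N" for q
    using threshold_reach(2)[OF threshold_0_le_greedy] threshold_1_le_greedy_iff[of q] that by simp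
  then show ?thesis by (auto simp: saturated_iff level_greedy greedy_counts_def)
qed

lemma ex_admissible:
  assumes "\<epsilon> > 0"
  shows "\<exists>p. p \<in> admissible \<epsilon> \<kappa> \<delta> \<gamma>0 \<alpha>"
proof -
  have "(\<lambda>k. \<alpha> ^ k * (\<kappa> 1 - greedy N)) \<longlonglongrightarrow> 0"
    using \<alpha>_pos \<alpha>_less_1 by (intro tendsto_mult_left_zero LIMSEQ_power_zero) simp
  then have "eventually (\<lambda>k. \<alpha> ^ k * (\<kappa> 1 - greedy N) < \<epsilon>) sequentially"
    using assms by (rule order_tendstoD)
  then obtain k where "\<alpha> ^ k * (\<kappa> 1 - greedy N) < \<epsilon>"
    by (auto dest: eventually_happens)
  then show ?thesis using admissible_greedy[of "N + k" \<epsilon>] greedy_after_N[of k] by fastforce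
qed

section \<open>Saturated paths are greedy\<close>

text \<open>A step that meets its tolerance with equality goes to the only load whose threshold is the
  current level, that is, to the load of the greedy step.\<close>

lemma saturated_level:
  assumes adm: "(Suc n, P, s) \<in> admissible \<epsilon> \<kappa> \<delta> \<gamma>0 \<alpha>"
    and sat: "saturated \<kappa> \<delta> \<gamma>0 \<alpha> (Suc n, P, s)" and "q \<le> n"
  shows "level P s q = greedy q"
  using \<open>q \<le> n\<close>
proof (induction q)
  case 0
  then show ?case using adm by (simp add: admissible_iff level_0)
next
  case (Suc q)
  then have "P (Suc q) = 1" "threshold (s (Suc q)) = greedy q"
    using sat by (simp_all add: saturated_iff)
  moreover have "s (Suc q) \<in> {0..1}" using admissible_loads[OF adm] Suc.prems by simp
  ultimately have "s (Suc q) = reach (greedy q)" using reach_threshold by metis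
  then show ?case using Suc \<open>P (Suc q) = 1\<close> by (simp add: level_Suc)
qed

text \<open>The last step must be permitted at load 1, which bounds the length from below. No load has
  a threshold above that of load 1, so equality in the tolerance fails once the greedy level has
  passed \<open>threshold 1\<close>, which bounds it from above. The second alternative is the case
  \<open>greedy N = threshold 1\<close>.\<close>

lemma saturated_length:
  assumes adm: "(Q, P, s) \<in> admissible \<epsilon> \<kappa> \<delta> \<gamma>0 \<alpha>"
    and sat: "saturated \<kappa> \<delta> \<gamma>0 \<alpha> (Q, P, s)"
  shows "Q = Suc N \<or> (Q = Suc N + 1 \<and> s (Suc N) = 1)"
proof -
  obtain n where Q: "Q = Suc n" using adm by (cases Q) (auto simp: admissible_iff)
  note adm = adm[unfolded Q] and sat = sat[unfolded Q]
  have "threshold 1 \<le> greedy n"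
    using adm saturated_level[OF adm sat, of n] by (auto simp: admissible_iff)
  then have "N \<le> n" by (simp add: threshold_1_le_greedy_iff)
  have load: "s (Suc q) \<in> {0..1}" "threshold (s (Suc q)) = greedy q" if "q < n" for q
    using that sat saturated_level[OF adm sat, of q] admissible_loads[OF adm, of "Suc q"]
    by (simp_all add: saturated_iff)
  have "n \<le> Suc N"
  proof (rule ccontr)
    assume "\<not> n \<le> Suc N"
    then have "threshold 1 < threshold (s (Suc (Suc N)))"
      using load(2)[of "Suc N"] greedy_gt_threshold_1[of "Suc N"] by simp
    then show False
      using threshold_le_iff[of "s (Suc (Suc N))" 1] load(1)[of "Suc N"] \<open>\<not> n \<le> Suc N\<close> by simp
  qed
  moreover have "s (Suc N) = 1" if "n = Suc N"
    using load[of N] that reach_threshold[of "s (Suc N)"] by simp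
  ultimately show ?thesis using \<open>N \<le> n\<close> Q by auto
qed

end

section \<open>Optimality of the greedy path\<close>

(* Without a proviso, Q is not unique: if the last step (to load 1) also meets the tolerance with
   equality, it can be split into two steps at load 1 (one iteration, then the remaining ones)
   with the same work and final error.  This is the only exception: Q is unique among the
   paths that reach load 1 in the last step only, and the witness is such a path. *)
theorem lemma7p2:
  fixes \<epsilon> \<gamma>0 \<alpha> :: real and \<kappa> \<delta> :: "real \<Rightarrow> real"
  assumes "\<epsilon> > 0"
    and "continuous_on {0..1} \<kappa>" and "strict_mono_on {0..1} \<kappa>" and "\<forall>x\<in>{0..1}. \<kappa> x \<ge> 0"
    and "continuous_on {0..1} \<delta>" and "antimono_on {0..1} \<delta>" and "\<forall>x\<in>{0..1}. \<delta> x > 0"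
    and "0 \<le> \<gamma>0" and "\<gamma>0 < \<delta> 0"
    and "0 < \<alpha>" and "\<alpha> < 1"
  defines "A_min \<equiv> admissible_upto \<epsilon> \<kappa> \<delta> \<gamma>0 \<alpha> (W_min \<epsilon> \<kappa> \<delta> \<gamma>0 \<alpha>)"
  shows "\<exists>Q P s. (Q, P, s) \<in> A_min \<and> saturated \<kappa> \<delta> \<gamma>0 \<alpha> (Q, P, s) \<and> (\<forall>q<Q. s q < 1) \<and>
    (\<forall>Q' P' s'. (Q', P', s') \<in> A_min \<and> saturated \<kappa> \<delta> \<gamma>0 \<alpha> (Q', P', s') \<longrightarrow>
       Q' = Q \<or> (Q' = Q + 1 \<and> s' Q = 1)) \<and>
    (\<forall>Q' P' s'. (Q', P', s') \<in> A_min \<longrightarrow>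
       err \<kappa> \<gamma>0 \<alpha> P s Q \<le> err \<kappa> \<gamma>0 \<alpha> P' s' Q')"
proof -
  interpret loading \<kappa> \<delta> \<gamma>0 \<alpha>
    using assms by unfold_locales auto
  let ?A = "admissible \<epsilon> \<kappa> \<delta> \<gamma>0 \<alpha>" and ?W = "W_min \<epsilon> \<kappa> \<delta> \<gamma>0 \<alpha>"
  have "\<exists>p\<in>?A. work p = ?W"
    unfolding W_min_def by (rule LeastI_ex) (use ex_admissible[OF \<open>\<epsilon> > 0\<close>] in blast)
  then obtain Q P s where p: "(Q, P, s) \<in> ?A" "work (Q, P, s) = ?W"
    by (metis prod_cases3)
  let ?P = "greedy_counts ?W" and ?s = greedy_loads
  have N: "N \<le> ?W" using admissible_imp_greedy(1)[OF p(1)] p(2) by simp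
  have "err \<kappa> \<gamma>0 \<alpha> P s Q \<le> \<epsilon>" using p(1) by (simp add: admissible_def)
  then have "\<kappa> 1 - greedy ?W \<le> \<epsilon>" using admissible_imp_greedy(2)[OF p(1)] p(2) by simp
  then have "(Suc N, ?P, ?s) \<in> A_min"
    unfolding A_min_def admissible_upto_def
    using admissible_greedy[OF N] work_greedy[OF N] by simp
  moreover have "\<forall>q<Suc N. ?s q < 1" using greedy_loads_less_1 by simp
  moreover have "err \<kappa> \<gamma>0 \<alpha> ?P ?s (Suc N) \<le> err \<kappa> \<gamma>0 \<alpha> P' s' Q'"
    if "(Q', P', s') \<in> A_min" for Q' P' s'
  proof -
    have adm: "(Q', P', s') \<in> ?A" and "work (Q', P', s') \<le> ?W"
      using that by (simp_all add: A_min_def admissible_upto_def)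
    then have "\<kappa> 1 - greedy ?W \<le> \<kappa> 1 - greedy (work (Q', P', s'))"
      using greedy_mono by (intro diff_left_mono) blast
    also have "\<dots> \<le> err \<kappa> \<gamma>0 \<alpha> P' s' Q'" by (rule admissible_imp_greedy(2)[OF adm])
    finally show ?thesis by (simp only: err_greedy_final[OF N])
  qed
  moreover have "Q' = Suc N \<or> (Q' = Suc N + 1 \<and> s' (Suc N) = 1)"
    if "(Q', P', s') \<in> A_min" "saturated \<kappa> \<delta> \<gamma>0 \<alpha> (Q', P', s')" for Q' P' s'
    using that saturated_length[of Q' P' s' \<epsilon>] by (simp add: A_min_def admissible_upto_def)
  ultimately show ?thesis using saturated_greedy by blast
qed

end
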